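(* Let $D\subset\mathbb R^2$ be an open set with coordinates $(x,y)$, and let $\gamma:D\to D$ be a diffeomorphism that separately preserves $x$- and $y$-coordinate lines, i.e. $\gamma(x,y)=(\gamma_1,\gamma_2)$ with $\partial\gamma_1/\partial y=0$ and $\partial\gamma_2/\partial x=0$. Let $G^X_\sharp(x,\lambda)$ and $G^Y_\flat(y,\lambda)$ be smooth $\widetilde\Lambda SU(2)$-valued functions on $D$, with $G^X_\sharp$ having no $y$-dependence and $G^Y_\flat$ having no $x$-dependence, such that $$G^Y_\flat\circ\gamma=\chi\,G^Y_\flat\,W^Y_+,\qquad G^X_\sharp\circ\gamma=\chi\,G^X_\sharp\,W^X_-$$ for some $W^Y_+(y,\lambda)\in\Lambda^+SU(2)$ (no $x$-dependence), some $W^X_-(x,\lambda)\in\Lambda^-SU(2)$ (no $y$-dependence), and the same $\chi(\lambda)\in SU(2)$ in both equations ($\chi$ independent of $x,y$). Then there exist $U(x,y;\lambda)$, $L_+(x,y)\in\Lambda^+SU(2)$ and $L_-(x,y)\in\Lambda^-SU(2)$ satisfying $$U=G^Y_\flat L_+=G^X_\sharp L_-$$ on $D$, and a $K(x,y)\in SU(2)$ (independent of $\lambda$), such that $$U\circ\gamma=\chi\,U\,K$$ for every $\lambda$.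
   Context: $\mathbb R^*=\mathbb R\setminus\{0\}$, $\mathbb C^*=\mathbb C\setminus\{0\}$, $\sigma_3=\operatorname{diag}(1,-1)$. $\widetilde\Lambda SU(2)$ is the group of maps $g:\mathbb R^*\to SU(2)$ satisfying the twisting condition $g(-\lambda)=\sigma_3\,g(\lambda)\,\sigma_3^{-1}$ which extend to analytic maps $\mathbb C^*\to SL(2,\mathbb C)$. $\Lambda^+SU(2)$ (resp. $\Lambda^-SU(2)$) is the subgroup of those $g$ with expansion $g=g_0+\lambda g_1+\lambda^2g_2+\cdots$ (resp. $g=g_0+\lambda^{-1}g_1+\lambda^{-2}g_2+\cdots$); $\Lambda^\pm_*SU(2)$ is the subgroup of $\Lambda^\pm SU(2)$ with $g_0=I$. Known fact (Birkhoff decomposition; may be used): the multiplication maps $\Lambda^+_*SU(2)\times\Lambda^-SU(2)\to\widetilde\Lambda SU(2)$ and $\Lambda^-_*SU(2)\times\Lambda^+SU(2)\to\widetilde\Lambda SU(2)$ are diffeomorphisms. Composition with $\gamma$ acts on the $(x,y)$ variables only. *)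

theory Defs
  imports "HOL-Analysis.Analysis"
begin

text \<open>
  Smooth maps on open subsets of a real normed space: \<open>k\<close>-fold continuous differentiability is
  defined by recursion over directional derivatives.  Both notions are meant for open \<open>S\<close> only.
\<close>

primrec Ck_on :: "nat \<Rightarrow> 'a::real_normed_vector set \<Rightarrow> ('a \<Rightarrow> 'b::real_normed_vector) \<Rightarrow> bool" where
  "Ck_on 0 S f \<longleftrightarrow> continuous_on S f"
| "Ck_on (Suc k) S f \<longleftrightarrow>
     (\<forall>x\<in>S. f differentiable (at x)) \<and> (\<forall>v. Ck_on k S (\<lambda>x. frechet_derivative f (at x) v))"

definition smooth_on :: "'a::real_normed_vector set \<Rightarrow> ('a \<Rightarrow> 'b::real_normed_vector) \<Rightarrow> bool" where
  "smooth_on S f \<longleftrightarrow> (\<forall>k. Ck_on k S f)"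

definition diffeomorphism_on :: "'a::real_normed_vector set \<Rightarrow> ('a \<Rightarrow> 'a) \<Rightarrow> bool" where
  "diffeomorphism_on S f \<longleftrightarrow> bij_betw f S S \<and> smooth_on S f \<and> smooth_on S (inv_into S f)"

definition cadjoint :: "complex^2^2 \<Rightarrow> complex^2^2" where
  "cadjoint A = (\<chi> i j. cnj (A $ j $ i))"

definition SU2 :: "(complex^2^2) set" where
  "SU2 = {A. cadjoint A ** A = mat 1 \<and> det A = 1}"

definition SL2 :: "(complex^2^2) set" where
  "SL2 = {A. det A = 1}"

definition sigma3 :: "complex^2^2" where
  "sigma3 = vector [vector [1, 0], vector [0, -1]]"

text \<open>
  A loop is a map on the punctured real line.  It is represented by an extensional function
  (value \<open>undefined\<close> at \<open>0\<close>), so that equality of loops is equality of functions.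
\<close>

type_synonym loop = "real \<Rightarrow> complex^2^2"

definition loop_mult :: "loop \<Rightarrow> loop \<Rightarrow> loop"  (infixl "\<cdot>\<^sub>l" 70) where
  "g \<cdot>\<^sub>l h = (\<lambda>t\<in>-{0}. g t ** h t)"

definition analytic_extension :: "loop \<Rightarrow> (complex \<Rightarrow> complex^2^2) \<Rightarrow> bool" where
  "analytic_extension g F \<longleftrightarrow>
     (\<forall>i j. (\<lambda>z. F z $ i $ j) analytic_on -{0}) \<and>
     (\<forall>z. z \<noteq> 0 \<longrightarrow> F z \<in> SL2) \<and>
     (\<forall>t. t \<noteq> 0 \<longrightarrow> F (complex_of_real t) = g t)"

definition LoopSU2 :: "loop set" where
  "LoopSU2 = {g \<in> (-{0}) \<rightarrow>\<^sub>E SU2.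
     (\<forall>t. t \<noteq> 0 \<longrightarrow> g (-t) = sigma3 ** g t ** matrix_inv sigma3) \<and>
     (\<exists>F. analytic_extension g F)}"

definition expansion_plus :: "loop \<Rightarrow> (nat \<Rightarrow> complex^2^2) \<Rightarrow> bool" where
  "expansion_plus g c \<longleftrightarrow> (\<forall>t. t \<noteq> 0 \<longrightarrow> (\<lambda>n. t ^ n *\<^sub>R c n) sums g t)"

definition expansion_minus :: "loop \<Rightarrow> (nat \<Rightarrow> complex^2^2) \<Rightarrow> bool" where
  "expansion_minus g c \<longleftrightarrow> (\<forall>t. t \<noteq> 0 \<longrightarrow> (\<lambda>n. inverse t ^ n *\<^sub>R c n) sums g t)"

definition LoopPlus :: "loop set" where
  "LoopPlus = {g \<in> LoopSU2. \<exists>c. expansion_plus g c}"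

definition LoopMinus :: "loop set" where
  "LoopMinus = {g \<in> LoopSU2. \<exists>c. expansion_minus g c}"

definition LoopPlusStar :: "loop set" where
  "LoopPlusStar = {g \<in> LoopSU2. \<exists>c. expansion_plus g c \<and> c 0 = mat 1}"

definition LoopMinusStar :: "loop set" where
  "LoopMinusStar = {g \<in> LoopSU2. \<exists>c. expansion_minus g c \<and> c 0 = mat 1}"

text \<open>
  Smoothness of a loop group valued map on an open set \<open>D\<close> refers to the topology of uniform
  convergence of the analytic extensions on compact subsets of the punctured complex plane.  By
  Cauchy's estimates, this is joint smoothness of the extensions in the point of \<open>D\<close> and the loop
  parameter.
\<close>

definition smooth_loops_on :: "(real \<times> real) set \<Rightarrow> (real \<times> real \<Rightarrow> loop) \<Rightarrow> bool" where
  "smooth_loops_on D f \<longleftrightarrow>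
     (\<forall>p\<in>D. f p \<in> LoopSU2) \<and>
     (\<exists>F. (\<forall>p\<in>D. analytic_extension (f p) (F p)) \<and>
          smooth_on (D \<times> -{0}) (\<lambda>(p, z). F p z))"

text \<open>
  The multiplication map \<open>A \<times> B \<rightarrow> LoopSU2\<close> is a diffeomorphism.  Smoothness of a map between
  these infinite-dimensional spaces is tested, as in convenient calculus, on smooth maps from
  open subsets of the plane (by Boman's theorem smooth curves would already suffice): the
  product of two maps is smooth (the multiplication is smooth), and conversely the factors of a
  smooth map are smooth (its inverse is smooth).
\<close>

definition mult_diffeomorphism :: "loop set \<Rightarrow> loop set \<Rightarrow> bool" where
  "mult_diffeomorphism A B \<longleftrightarrow>
     bij_betw (\<lambda>(a, b). a \<cdot>\<^sub>l b) (A \<times> B) LoopSU2 \<and>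
     (\<forall>D a b. open D \<and> (\<forall>p\<in>D. a p \<in> A \<and> b p \<in> B) \<longrightarrow>
        (smooth_loops_on D (\<lambda>p. a p \<cdot>\<^sub>l b p) \<longleftrightarrow> smooth_loops_on D a \<and> smooth_loops_on D b))"

definition birkhoff_decomposition :: bool where
  "birkhoff_decomposition \<longleftrightarrow>
     mult_diffeomorphism LoopPlusStar LoopMinus \<and> mult_diffeomorphism LoopMinusStar LoopPlus"

text \<open>
  Independence of one coordinate means that the map is locally constant along the corresponding
  coordinate lines; for differentiable maps this says that the partial derivative vanishes.  If
  the coordinate lines meet \<open>D\<close> in disconnected sets, this is weaker than being a function of the
  other coordinate alone.
\<close>

definition indep_y_on :: "(real \<times> real) set \<Rightarrow> (real \<times> real \<Rightarrow> 'a) \<Rightarrow> bool" where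
  "indep_y_on D f \<longleftrightarrow> (\<forall>(x, y)\<in>D. \<forall>\<^sub>F y' in nhds y. f (x, y') = f (x, y))"

definition indep_x_on :: "(real \<times> real) set \<Rightarrow> (real \<times> real \<Rightarrow> 'a) \<Rightarrow> bool" where
  "indep_x_on D f \<longleftrightarrow> (\<forall>(x, y)\<in>D. \<forall>\<^sub>F x' in nhds x. f (x', y) = f (x, y))"

definition preserves_coordinate_lines :: "(real \<times> real) set \<Rightarrow> (real \<times> real \<Rightarrow> real \<times> real) \<Rightarrow> bool" where
  "preserves_coordinate_lines D \<gamma> \<longleftrightarrow>
     (\<forall>(x, y)\<in>D. ((\<lambda>t. fst (\<gamma> (x, t))) has_real_derivative 0) (at y) \<and>
                 ((\<lambda>t. snd (\<gamma> (t, y))) has_real_derivative 0) (at x))"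

end

theory Submission
  imports Defs
begin

text \<open>
  The Birkhoff decomposition of \<open>GX\<^sup>-\<^sup>1 GY = H\<^sub>- H\<^sub>+\<close> gives \<open>U = GX H\<^sub>- = GY H\<^sub>+\<^sup>-\<^sup>1\<close>.  By
  equivariance of \<open>GX\<close> and \<open>GY\<close>, the loop \<open>k = (chi U)\<^sup>-\<^sup>1 (U \<circ> \<gamma>)\<close> equals both
  \<open>H\<^sub>-\<^sup>-\<^sup>1 WX (H\<^sub>- \<circ> \<gamma>)\<close> and \<open>H\<^sub>+ WY (H\<^sub>+ \<circ> \<gamma>)\<^sup>-\<^sup>1\<close>, so it is simultaneously a plus and a minus
  loop and hence constant.  Its smoothness in the point is read off at the loop parameter \<open>1\<close>.
\<close>

subsection \<open>Smooth maps\<close>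

text \<open>Since \<open>S\<close> is open, \<open>f\<close> and \<open>g\<close> agree near each
  point of \<open>S\<close>. Hence their derivatives agree on \<open>S\<close>, and the induction
  passes to them.\<close>

lemma Ck_on_cong:
  assumes "open S" "\<And>x. x \<in> S \<Longrightarrow> f x = g x" "Ck_on k S f"
  shows "Ck_on k S g"
  using assms(2,3)
proof (induction k arbitrary: f g)
  case 0
  then show ?case by (simp cong: continuous_on_cong)
next
  case (Suc k)
  have D: "(g has_derivative frechet_derivative f (at x)) (at x)" if "x \<in> S" for x
    using Suc.prems that \<open>open S\<close>
    by (metis Ck_on.simps(2) frechet_derivative_works has_derivative_transform_within_open)
  then have E: "frechet_derivative f (at x) = frechet_derivative g (at x)" if "x \<in> S" for x
    using frechet_derivative_at that by blast
  have "Ck_on k S (\<lambda>x. frechet_derivative g (at x) v)" for v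
    by (rule Suc.IH[of "\<lambda>x. frechet_derivative f (at x) v"]) (use E Suc.prems in auto)
  then show ?case using D by (auto simp: differentiable_def)
qed

text \<open>\<open>frechet_derivative\<close> is given by choice; uniqueness of derivatives lets the
  closure proofs below work with an explicit \<open>f'\<close> instead.\<close>

lemma Ck_on_SucI:
  assumes "open S" "\<And>x. x \<in> S \<Longrightarrow> (f has_derivative f' x) (at x)"
    "\<And>v. Ck_on k S (\<lambda>x. f' x v)"
  shows "Ck_on (Suc k) S f"
proof -
  have "f' x = frechet_derivative f (at x)" if "x \<in> S" for x
    using assms(2) that frechet_derivative_at by blast
  then have "Ck_on k S (\<lambda>x. frechet_derivative f (at x) v)" for v
    by (intro Ck_on_cong[OF assms(1) _ assms(3)[of v]]) auto
  then show ?thesis using assms(2) by (auto simp: differentiable_def)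
qed

text \<open>The recursion asks for continuity only at level 0. There differentiability supplies it;
  higher up the induction hypothesis is applied to the directional derivatives.\<close>

lemma Ck_on_SucD:
  assumes "Ck_on (Suc k) S f"
  shows "Ck_on k S f"
  using assms
proof (induction k arbitrary: f)
  case 0
  then show ?case
    by (auto intro!: continuous_at_imp_continuous_on differentiable_imp_continuous_within)
qed auto

lemma Ck_on_has_derivative:
  "Ck_on (Suc k) S f \<Longrightarrow> x \<in> S \<Longrightarrow> (f has_derivative frechet_derivative f (at x)) (at x)"
  by (simp add: frechet_derivative_works)

lemma Ck_on_const: "open S \<Longrightarrow> Ck_on k S (\<lambda>x. c)"
proof (induction k arbitrary: c)
  case (Suc k)
  show ?case
    by (rule Ck_on_SucI[where f' = "\<lambda>_ _. 0"]) (use Suc in auto)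
qed auto

lemma Ck_on_add:
  assumes "open S"
  shows "Ck_on k S f \<Longrightarrow> Ck_on k S g \<Longrightarrow> Ck_on k S (\<lambda>x. f x + g x)"
proof (induction k arbitrary: f g)
  case 0
  then show ?case by (auto intro: continuous_on_add)
next
  case (Suc k)
  show ?case
    by (rule Ck_on_SucI[OF assms has_derivative_add[OF Ck_on_has_derivative Ck_on_has_derivative]])
      (use Suc in auto)
qed

lemma Ck_on_sum:
  assumes "open S" "\<And>i. i \<in> I \<Longrightarrow> Ck_on k S (f i)"
  shows "Ck_on k S (\<lambda>x. \<Sum>i\<in>I. f i x)"
  using assms(2)
  by (induction I rule: infinite_finite_induct) (auto intro: Ck_on_const Ck_on_add assms(1))

lemma Ck_on_linear:
  assumes "open S" "bounded_linear h"
  shows "Ck_on k S f \<Longrightarrow> Ck_on k S (\<lambda>x. h (f x))"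
proof (induction k arbitrary: f)
  case 0
  then show ?case using bounded_linear.continuous_on[OF assms(2)] by auto
next
  case (Suc k)
  show ?case
    by (rule Ck_on_SucI[OF assms(1) bounded_linear.has_derivative[OF assms(2) Ck_on_has_derivative]])
      (use Suc in auto)
qed

text \<open>Each term of the product rule leaves one factor undifferentiated, so the induction also
  needs \<open>f\<close> and \<open>g\<close> themselves at level \<open>k\<close>.\<close>

lemma Ck_on_bilinear:
  assumes "open S" "bounded_bilinear h"
  shows "Ck_on k S f \<Longrightarrow> Ck_on k S g \<Longrightarrow> Ck_on k S (\<lambda>x. h (f x) (g x))"
proof (induction k arbitrary: f g)
  case 0
  then show ?case using bounded_bilinear.continuous_on[OF assms(2)] by auto
next
  case (Suc k)
  have "Ck_on k S f" "Ck_on k S g"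
    using Suc.prems Ck_on_SucD by blast+
  then show ?case
    by (intro Ck_on_SucI[OF assms(1) bounded_bilinear.FDERIV[OF assms(2) Ck_on_has_derivative Ck_on_has_derivative]])
      (use Suc assms(1) in \<open>auto intro!: Ck_on_add\<close>)
qed

text \<open>The chain rule evaluates the derivative of \<open>f\<close> along a direction that
  varies with \<open>x\<close>, whereas \<open>Ck_on\<close> controls fixed directions. Expanding
  that direction in the basis of the middle space gives a finite sum of scalar coefficients times
  derivatives along basis vectors, to which the induction applies. This is why the middle space is
  Euclidean.\<close>

lemma Ck_on_compose:
  fixes \<gamma> :: "'a::real_normed_vector \<Rightarrow> 'b::euclidean_space"
  assumes "open S" "open T" "\<gamma> ` S \<subseteq> T"
  shows "Ck_on k T f \<Longrightarrow> Ck_on k S \<gamma> \<Longrightarrow> Ck_on k S (\<lambda>x. f (\<gamma> x))"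
proof (induction k arbitrary: f)
  case 0
  then show ?case using assms(3) by (auto intro: continuous_on_compose2)
next
  case (Suc k)
  let ?D = "\<lambda>x v. \<Sum>b\<in>Basis. (frechet_derivative \<gamma> (at x) v \<bullet> b) *\<^sub>R frechet_derivative f (at (\<gamma> x)) b"
  have der: "((\<lambda>x. f (\<gamma> x)) has_derivative ?D x) (at x)" if "x \<in> S" for x
  proof -
    have f: "(f has_derivative frechet_derivative f (at (\<gamma> x))) (at (\<gamma> x))"
      using Suc.prems(1) that assms(3) Ck_on_has_derivative by blast
    then interpret linear "frechet_derivative f (at (\<gamma> x))"
      by (rule has_derivative_linear)
    have "frechet_derivative f (at (\<gamma> x)) w = (\<Sum>b\<in>Basis. (w \<bullet> b) *\<^sub>R frechet_derivative f (at (\<gamma> x)) b)" for w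
      by (subst euclidean_representation[of w, symmetric], subst sum) (simp add: scale)
    then have "?D x = (\<lambda>v. frechet_derivative f (at (\<gamma> x)) (frechet_derivative \<gamma> (at x) v))"
      by metis
    then show ?thesis
      using has_derivative_compose[OF Ck_on_has_derivative[OF Suc.prems(2) that] f] by simp
  qed
  have "Ck_on k S \<gamma>"
    using Suc.prems Ck_on_SucD by blast
  then have "Ck_on k S (\<lambda>x. ?D x v)" for v
    using Suc by (intro Ck_on_sum Ck_on_bilinear[OF assms(1) bounded_bilinear_scaleR]
        Ck_on_linear[OF assms(1) bounded_linear_inner_left] assms(1)) auto
  then show ?case
    using Ck_on_SucI[OF assms(1) der] by blast
qed

text \<open>Compose with the embedding of the slice \<open>z = c\<close>. It is affine, so its
  directional derivatives are constant.\<close>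

lemma smooth_on_section:
  fixes c :: "'b::euclidean_space" and S :: "'a::euclidean_space set"
  assumes "open S" "open T" "c \<in> T" "smooth_on (S \<times> T) (\<lambda>(p, z). F p z)"
  shows "smooth_on S (\<lambda>p. F p c)"
proof -
  have "Ck_on k S (\<lambda>p. (p, c))" for k
  proof (cases k)
    case (Suc k)
    show ?thesis unfolding Suc
      by (rule Ck_on_SucI[where f' = "\<lambda>_ v. (v, 0)"])
        (auto intro!: derivative_eq_intros Ck_on_const assms)
  qed (auto intro: continuous_intros)
  then show ?thesis
    using assms Ck_on_compose[OF \<open>open S\<close>, of "S \<times> T" "\<lambda>p. (p, c)" _ "\<lambda>(p, z). F p z"]
    by (auto simp: smooth_on_def open_Times)
qed

subsection \<open>Two by two matrices\<close>

lemmas matrix2_simps =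
  vec_eq_iff forall_2 sum_2 matrix_matrix_mult_def mat_def det_2

text \<open>
  On \<open>SL2\<close> the adjugate is the inverse.  It is linear in the entries and does not involve complex
  conjugation, so it preserves both smoothness and analyticity in the loop parameter.
\<close>

definition adjugate2 :: "'a::comm_ring_1^2^2 \<Rightarrow> 'a^2^2" where
  "adjugate2 A = vector [vector [A $ 2 $ 2, - A $ 1 $ 2], vector [- A $ 2 $ 1, A $ 1 $ 1]]"

lemma adjugate2_nth [simp]:
  "adjugate2 A $ 1 $ 1 = A $ 2 $ 2" "adjugate2 A $ 1 $ 2 = - A $ 1 $ 2"
  "adjugate2 A $ 2 $ 1 = - A $ 2 $ 1" "adjugate2 A $ 2 $ 2 = A $ 1 $ 1"
  by (simp_all add: adjugate2_def)

lemma sigma3_nth [simp]: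
  "sigma3 $ 1 $ 1 = 1" "sigma3 $ 1 $ 2 = 0" "sigma3 $ 2 $ 1 = 0" "sigma3 $ 2 $ 2 = - 1"
  by (simp_all add: sigma3_def)

lemma det_adjugate2 [simp]: "det (adjugate2 A) = det A"
  by (simp add: det_2 algebra_simps)

lemma adjugate2_left: "det A = 1 \<Longrightarrow> adjugate2 A ** A = mat 1"
  by (simp add: matrix2_simps algebra_simps)

lemma adjugate2_right: "det A = 1 \<Longrightarrow> A ** adjugate2 A = mat 1"
  by (simp add: matrix2_simps algebra_simps)

lemma adjugate2_cancel:
  assumes "det A = 1"
  shows "A ** (adjugate2 A ** B) = B" "adjugate2 A ** (A ** B) = B"
  by (simp_all add: matrix_mul_assoc adjugate2_left adjugate2_right assms)

lemma adjugate2_mult: "adjugate2 (A ** B) = adjugate2 B ** adjugate2 A"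
  by (simp add: matrix2_simps algebra_simps)

lemma bounded_linear_adjugate2: "bounded_linear (adjugate2 :: complex^2^2 \<Rightarrow> complex^2^2)"
  by (intro linear_conv_bounded_linear[THEN iffD1] linearI) (simp_all add: matrix2_simps)

lemma bounded_bilinear_matrix_mult2: "bounded_bilinear ((**) :: complex^2^2 \<Rightarrow> complex^2^2 \<Rightarrow> complex^2^2)"
  unfolding bilinear_conv_bounded_bilinear[symmetric] bilinear_def
  by (auto intro!: linearI simp: matrix2_simps algebra_simps)

lemma sigma3_square: "sigma3 ** sigma3 = mat 1"
  by (simp add: matrix2_simps)

text \<open>\<open>matrix_inv\<close> is a choice operator; cancelling \<open>sigma3\<close> against
  its square pins the value down. The twisting condition then becomes free of inverses.\<close>

lemma matrix_inv_sigma3: "matrix_inv sigma3 = sigma3"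
proof -
  have "\<exists>B. sigma3 ** B = mat 1 \<and> B ** sigma3 = mat 1"
    using sigma3_square by blast
  then have "matrix_inv sigma3 ** sigma3 = mat 1"
    unfolding matrix_inv_def by (rule someI2_ex) simp
  then have "matrix_inv sigma3 ** sigma3 ** sigma3 = sigma3"
    by simp
  then show ?thesis
    by (simp only: matrix_mul_assoc[symmetric] sigma3_square matrix_mul_rid)
qed

lemma SU2_det: "A \<in> SU2 \<Longrightarrow> det A = 1"
  by (simp add: SU2_def)

lemma SU2_mult: "A \<in> SU2 \<Longrightarrow> B \<in> SU2 \<Longrightarrow> A ** B \<in> SU2"
proof -
  assume AB: "A \<in> SU2" "B \<in> SU2"
  have "cadjoint (A ** B) ** (A ** B) = cadjoint B ** (cadjoint A ** A) ** B"
    by (simp add: cadjoint_def matrix2_simps algebra_simps)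
  then show ?thesis using AB by (simp add: SU2_def det_mul)
qed

text \<open>On \<open>SU2\<close> the adjugate is the conjugate transpose, because both invert
  \<open>A\<close>.\<close>

lemma SU2_adjugate2:
  assumes "A \<in> SU2"
  shows "adjugate2 A \<in> SU2"
proof -
  have "adjugate2 A = cadjoint A ** A ** adjugate2 A"
    using assms by (simp add: SU2_def)
  also have "\<dots> = cadjoint A"
    using assms by (simp add: matrix_mul_assoc[symmetric] adjugate2_right SU2_det)
  finally have "cadjoint (adjugate2 A) = A"
    by (simp add: cadjoint_def vec_eq_iff)
  then show ?thesis
    using adjugate2_right[OF SU2_det[OF assms]] SU2_det[OF assms] by (simp add: SU2_def)
qed

text \<open>Used to see that the value of a minus loop at infinity stays in
  \<open>SU2\<close>.\<close>

lemma closed_SU2: "closed SU2"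
proof -
  have "continuous_on UNIV (\<lambda>A. cadjoint A ** A)"
    unfolding cadjoint_def matrix_matrix_mult_def by (intro continuous_intros)
  moreover have "continuous_on UNIV (det :: complex^2^2 \<Rightarrow> complex)"
    unfolding det_2 by (intro continuous_intros)
  ultimately have "closed ({A. cadjoint A ** A = mat 1} \<inter> {A. det A = 1})"
    by (intro closed_Int closed_Collect_eq continuous_on_const)
  then show ?thesis by (simp add: SU2_def Collect_conj_eq)
qed

subsection \<open>Loop groups\<close>

definition loop_inv :: "loop \<Rightarrow> loop" where
  "loop_inv g = (\<lambda>t\<in>-{0}. adjugate2 (g t))"

lemma loop_mult_apply [simp]: "t \<noteq> 0 \<Longrightarrow> (g \<cdot>\<^sub>l h) t = g t ** h t"
  by (simp add: loop_mult_def)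

lemma loop_inv_apply [simp]: "t \<noteq> 0 \<Longrightarrow> loop_inv g t = adjugate2 (g t)"
  by (simp add: loop_inv_def)

lemma LoopSU2_PiE: "g \<in> LoopSU2 \<Longrightarrow> g \<in> (-{0}) \<rightarrow>\<^sub>E SU2"
  by (simp add: LoopSU2_def)

lemma LoopSU2_SU2: "g \<in> LoopSU2 \<Longrightarrow> t \<noteq> 0 \<Longrightarrow> g t \<in> SU2"
  by (rule PiE_mem[OF LoopSU2_PiE]) auto

lemma LoopSU2_det: "g \<in> LoopSU2 \<Longrightarrow> t \<noteq> 0 \<Longrightarrow> det (g t) = 1"
  by (simp add: LoopSU2_SU2 SU2_det)

lemma loop_eqI:
  assumes "g \<in> LoopSU2" "h \<in> LoopSU2" "\<And>t. t \<noteq> 0 \<Longrightarrow> g t = h t"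
  shows "g = h"
  by (rule PiE_ext[OF assms(1,2)[THEN LoopSU2_PiE]]) (use assms(3) in auto)

lemma analytic_extension_mult:
  assumes "analytic_extension g F" "analytic_extension h G"
  shows "analytic_extension (g \<cdot>\<^sub>l h) (\<lambda>z. F z ** G z)"
  using assms unfolding analytic_extension_def SL2_def
  by (simp add: det_mul) (auto simp: matrix_matrix_mult_def intro!: analytic_intros)

lemma analytic_extension_inv:
  assumes "analytic_extension g F"
  shows "analytic_extension (loop_inv g) (\<lambda>z. adjugate2 (F z))"
  using assms unfolding analytic_extension_def SL2_def
  by (auto simp: forall_2 intro!: analytic_intros)

lemma LoopSU2_mult:
  assumes g: "g \<in> LoopSU2" and h: "h \<in> LoopSU2"
  shows "g \<cdot>\<^sub>l h \<in> LoopSU2"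
proof -
  have "sigma3 ** A ** sigma3 ** (sigma3 ** B ** sigma3) = sigma3 ** (A ** B) ** sigma3" for A B
  proof -
    have "sigma3 ** A ** sigma3 ** (sigma3 ** B ** sigma3) = sigma3 ** A ** (sigma3 ** sigma3) ** B ** sigma3"
      by (simp only: matrix_mul_assoc)
    then show ?thesis
      by (simp only: sigma3_square matrix_mul_rid matrix_mul_assoc)
  qed
  moreover have "\<exists>F. analytic_extension (g \<cdot>\<^sub>l h) F"
  proof -
    obtain F G where "analytic_extension g F" "analytic_extension h G"
      using g h by (auto simp: LoopSU2_def)
    then show ?thesis
      using analytic_extension_mult by blast
  qed
  moreover have "g \<cdot>\<^sub>l h \<in> (-{0}) \<rightarrow>\<^sub>E SU2"
    using g h by (auto simp: loop_mult_def LoopSU2_SU2 SU2_mult)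
  ultimately show ?thesis
    using g h by (simp add: LoopSU2_def matrix_inv_sigma3)
qed

lemma LoopSU2_inv:
  assumes g: "g \<in> LoopSU2"
  shows "loop_inv g \<in> LoopSU2"
proof -
  \<comment> \<open>The adjugate of \<open>sigma3\<close> is \<open>- sigma3\<close>; the two signs
    cancel, so inversion respects the twisting.\<close>
  have "adjugate2 (sigma3 ** A ** sigma3) = sigma3 ** adjugate2 A ** sigma3" for A
    by (simp add: matrix2_simps algebra_simps)
  moreover have "\<exists>F. analytic_extension (loop_inv g) F"
    using g analytic_extension_inv unfolding LoopSU2_def by blast
  moreover have "loop_inv g \<in> (-{0}) \<rightarrow>\<^sub>E SU2"
    using g by (auto simp: loop_inv_def LoopSU2_SU2 SU2_adjugate2)
  ultimately show ?thesis
    using g by (simp add: LoopSU2_def matrix_inv_sigma3)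
qed

text \<open>As \<open>sigma3\<close> squares to the identity, the second assumption says that
  \<open>C\<close> commutes with \<open>sigma3\<close>, which is the twisting condition for a
  constant loop.\<close>

lemma LoopSU2_const:
  assumes "C \<in> SU2" "sigma3 ** C ** sigma3 = C"
  shows "(\<lambda>t\<in>-{0}. C) \<in> LoopSU2"
proof -
  have "analytic_extension (\<lambda>t\<in>-{0}. C) (\<lambda>_. C)"
    using SU2_det[OF assms(1)] by (auto simp: analytic_extension_def SL2_def)
  then show ?thesis
    using assms by (auto simp: LoopSU2_def matrix_inv_sigma3)
qed

section \<open>Power series expansions at zero and at infinity\<close>

lemma expansion_minus_iff_plus:
  "expansion_minus g c \<longleftrightarrow> expansion_plus (\<lambda>s. g (inverse s)) c"
proof -
  \<comment> \<open>Inversion permutes the nonzero reals, so a minus expansion is a plus expansion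
    in the inverse parameter. Facts about minus loops are reduced to plus loops in this way.\<close>
  have "(\<forall>t::real. t \<noteq> 0 \<longrightarrow> P (inverse t) t) \<longleftrightarrow> (\<forall>t. t \<noteq> 0 \<longrightarrow> P t (inverse t))" for P
  proof (intro iffI allI impI)
    fix t :: real
    assume "\<forall>t. t \<noteq> 0 \<longrightarrow> P (inverse t) t" "t \<noteq> 0"
    from this(1)[rule_format, of "inverse t"] this(2) show "P t (inverse t)" by simp
  next
    fix t :: real
    assume "\<forall>t. t \<noteq> 0 \<longrightarrow> P t (inverse t)" "t \<noteq> 0"
    from this(1)[rule_format, of "inverse t"] this(2) show "P (inverse t) t" by simp
  qed
  from this[of "\<lambda>s t. (\<lambda>n. s ^ n *\<^sub>R c n) sums g t"] show ?thesis
    by (simp only: expansion_plus_def expansion_minus_def)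
qed

lemma expansion_plus_entry:
  assumes "expansion_plus g c" "t \<noteq> 0"
  shows "(\<lambda>n. c n $ i $ j * of_real t ^ n) sums (g t $ i $ j)"
  using sums_vec_nth[OF sums_vec_nth[OF assms(1)[unfolded expansion_plus_def, rule_format, OF assms(2)], of i], of j]
  by (simp add: scaleR_conv_of_real[where 'a=complex] mult.commute)

lemma expansion_plus_entryI:
  assumes "\<And>t i j. t \<noteq> 0 \<Longrightarrow> (\<lambda>n. c n $ i $ j * of_real t ^ n) sums (g t $ i $ j)"
  shows "expansion_plus g c"
  unfolding expansion_plus_def sums_def
  using assms
  by (intro allI impI vec_tendstoI) (simp add: sums_def scaleR_conv_of_real[where 'a=complex] mult.commute)

text \<open>The expansion converges at the real point \<open>norm z + 1\<close>, which is nonzero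
  and of larger modulus than \<open>z\<close>; a power series converges absolutely strictly inside
  its disc of convergence.\<close>

lemma expansion_plus_summable:
  fixes z :: complex
  assumes "expansion_plus g c"
  shows "summable (\<lambda>n. norm (c n $ i $ j * z ^ n))"
proof (rule powser_insidea)
  have "norm z + 1 \<noteq> 0"
    using norm_ge_zero[of z] by linarith
  then show "summable (\<lambda>n. c n $ i $ j * of_real (norm z + 1) ^ n)"
    by (rule sums_summable[OF expansion_plus_entry[OF assms]])
qed (simp del: of_real_add)

text \<open>Absolute convergence of the entries allows Cauchy products. The finite sum over the
  inner matrix index is then interchanged with the convolution sum.\<close>

lemma expansion_plus_mult:
  assumes a: "expansion_plus g a" and b: "expansion_plus h b"
  shows "expansion_plus (\<lambda>t. g t ** h t) (\<lambda>n. \<Sum>i\<le>n. a i ** b (n - i))"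
proof (rule expansion_plus_entryI)
  fix t :: real and p q :: 2
  assume t: "t \<noteq> 0"
  have "(\<lambda>n. \<Sum>i\<le>n. (a i $ p $ k * of_real t ^ i) * (b (n - i) $ k $ q * of_real t ^ (n - i)))
      sums (g t $ p $ k * h t $ k $ q)" for k
    using Cauchy_product_sums[OF expansion_plus_summable[OF a, of p k "of_real t"]
        expansion_plus_summable[OF b, of k q "of_real t"]]
    by (simp only: sums_unique[OF expansion_plus_entry[OF a t], symmetric]
        sums_unique[OF expansion_plus_entry[OF b t], symmetric])
  then have "(\<lambda>n. \<Sum>k\<in>UNIV. \<Sum>i\<le>n. (a i $ p $ k * of_real t ^ i) * (b (n - i) $ k $ q * of_real t ^ (n - i)))
      sums (\<Sum>k\<in>UNIV. g t $ p $ k * h t $ k $ q)"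
    by (intro sums_sum)
  moreover have "(\<Sum>k\<in>UNIV. \<Sum>i\<le>n. (a i $ p $ k * of_real t ^ i) * (b (n - i) $ k $ q * of_real t ^ (n - i)))
      = (\<Sum>i\<le>n. a i ** b (n - i)) $ p $ q * of_real t ^ n" for n
  proof -
    have "(\<Sum>k\<in>UNIV. \<Sum>i\<le>n. (a i $ p $ k * of_real t ^ i) * (b (n - i) $ k $ q * of_real t ^ (n - i)))
        = (\<Sum>k\<in>UNIV. \<Sum>i\<le>n. a i $ p $ k * b (n - i) $ k $ q * of_real t ^ n)"
      by (intro sum.cong refl) (simp add: power_add[symmetric] algebra_simps)
    also have "\<dots> = (\<Sum>i\<le>n. \<Sum>k\<in>UNIV. a i $ p $ k * b (n - i) $ k $ q * of_real t ^ n)"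
      by (rule sum.swap)
    finally show ?thesis
      by (simp add: matrix_matrix_mult_def sum_distrib_right)
  qed
  ultimately show "(\<lambda>n. (\<Sum>i\<le>n. a i ** b (n - i)) $ p $ q * of_real t ^ n) sums ((g t ** h t) $ p $ q)"
    by (simp add: matrix_matrix_mult_def)
qed

lemma expansion_plus_adjugate2:
  assumes "expansion_plus g c"
  shows "expansion_plus (\<lambda>t. adjugate2 (g t)) (\<lambda>n. adjugate2 (c n))"
  using assms bounded_linear.sums[OF bounded_linear_adjugate2]
  by (fastforce simp: expansion_plus_def linear_simps(5)[OF bounded_linear_adjugate2])

lemma expansion_plus_const: "expansion_plus (\<lambda>_. C) (\<lambda>n. if n = 0 then C else 0)"
proof -
  have "(\<lambda>n. t ^ n *\<^sub>R (if n = 0 then C else 0)) = (\<lambda>n. if n = 0 then C else 0)" for t :: real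
    by auto
  then show ?thesis
    using sums_single[of 0 "\<lambda>_. C"] by (simp add: expansion_plus_def)
qed

text \<open>Each entry is the restriction of an entire power series, which is continuous at 0. With
  the parameter inverted, this gives the value of a minus loop at infinity.\<close>

lemma expansion_plus_tendsto:
  assumes "expansion_plus g c"
  shows "(g \<longlongrightarrow> c 0) (at 0)"
proof (intro vec_tendstoI)
  fix i j
  define f where "f = (\<lambda>z::complex. \<Sum>n. c n $ i $ j * z ^ n)"
  have "(\<lambda>n. c n $ i $ j * z ^ n) sums f z" for z
    unfolding f_def by (rule summable_sums[OF summable_norm_cancel[OF expansion_plus_summable[OF assms]]])
  \<comment> \<open>The series converges on the whole plane, so the radius 1 passed to
    \<open>powser_limit_0\<close> is an arbitrary choice.\<close>
  then have "(f \<longlongrightarrow> c 0 $ i $ j) (at 0)"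
    by (intro powser_limit_0[of 1]) simp_all
  moreover have "filterlim complex_of_real (at 0) (at 0)"
    by (auto simp: filterlim_at eventually_at_filter intro!: tendsto_eq_intros)
  ultimately have "((\<lambda>t. f (of_real t)) \<longlongrightarrow> c 0 $ i $ j) (at (0::real))"
    by (rule filterlim_compose)
  moreover have "\<forall>\<^sub>F t in at 0. f (of_real t) = g t $ i $ j"
    using sums_unique[OF expansion_plus_entry[OF assms]]
    by (auto simp: f_def eventually_at_filter)
  ultimately show "((\<lambda>t. g t $ i $ j) \<longlongrightarrow> c 0 $ i $ j) (at 0)"
    by (rule Lim_transform_eventually)
qed

lemma expansion_plus_cong:
  "(\<And>t. t \<noteq> 0 \<Longrightarrow> g t = h t) \<Longrightarrow> expansion_plus g c \<longleftrightarrow> expansion_plus h c"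
  by (simp add: expansion_plus_def)

text \<open>The loop product is the pointwise product at nonzero parameters, which are all that an
  expansion sees.\<close>

lemma expansion_loop_mult:
  "expansion_plus g a \<Longrightarrow> expansion_plus h b \<Longrightarrow>
    expansion_plus (g \<cdot>\<^sub>l h) (\<lambda>n. \<Sum>i\<le>n. a i ** b (n - i))"
  "expansion_minus g a \<Longrightarrow> expansion_minus h b \<Longrightarrow>
    expansion_minus (g \<cdot>\<^sub>l h) (\<lambda>n. \<Sum>i\<le>n. a i ** b (n - i))"
  unfolding expansion_minus_iff_plus
  by (drule (1) expansion_plus_mult, erule expansion_plus_cong[THEN iffD1, rotated], simp)+

lemma expansion_loop_inv:
  "expansion_plus g a \<Longrightarrow> expansion_plus (loop_inv g) (\<lambda>n. adjugate2 (a n))"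
  "expansion_minus g a \<Longrightarrow> expansion_minus (loop_inv g) (\<lambda>n. adjugate2 (a n))"
  unfolding expansion_minus_iff_plus
  by (drule expansion_plus_adjugate2, erule expansion_plus_cong[THEN iffD1, rotated], simp)+

lemma expansion_loop_const:
  "expansion_plus (\<lambda>t\<in>-{0}. C) (\<lambda>n. if n = 0 then C else 0)"
  "expansion_minus (\<lambda>t\<in>-{0}. C) (\<lambda>n. if n = 0 then C else 0)"
  unfolding expansion_minus_iff_plus
  by (rule expansion_plus_cong[THEN iffD1, OF _ expansion_plus_const], simp)+

section \<open>The plus and minus subgroups and their intersection\<close>

lemma LoopPlus_mult: "g \<in> LoopPlus \<Longrightarrow> h \<in> LoopPlus \<Longrightarrow> g \<cdot>\<^sub>l h \<in> LoopPlus"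
  by (auto simp: LoopPlus_def LoopSU2_mult dest: expansion_loop_mult(1))

lemma LoopMinus_mult: "g \<in> LoopMinus \<Longrightarrow> h \<in> LoopMinus \<Longrightarrow> g \<cdot>\<^sub>l h \<in> LoopMinus"
  by (auto simp: LoopMinus_def LoopSU2_mult dest: expansion_loop_mult(2))

lemma LoopPlus_inv: "g \<in> LoopPlus \<Longrightarrow> loop_inv g \<in> LoopPlus"
  by (auto simp: LoopPlus_def LoopSU2_inv dest: expansion_loop_inv(1))

lemma LoopMinus_inv: "g \<in> LoopMinus \<Longrightarrow> loop_inv g \<in> LoopMinus"
  by (auto simp: LoopMinus_def LoopSU2_inv dest: expansion_loop_inv(2))

lemma LoopPlus_LoopSU2: "g \<in> LoopPlus \<Longrightarrow> g \<in> LoopSU2"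
  by (simp add: LoopPlus_def)

lemma LoopMinus_LoopSU2: "g \<in> LoopMinus \<Longrightarrow> g \<in> LoopSU2"
  by (simp add: LoopMinus_def)

lemma LoopMinusStar_LoopMinus: "g \<in> LoopMinusStar \<Longrightarrow> g \<in> LoopMinus"
  by (auto simp: LoopMinusStar_def LoopMinus_def)

text \<open>
  Both \<open>1 \<cdot> g\<close> and \<open>(g C\<^sup>-\<^sup>1) \<cdot> C\<close>, with \<open>C\<close> the value of \<open>g\<close> at infinity, are Birkhoff
  decompositions of \<open>g\<close>; their uniqueness replaces Liouville's theorem.
\<close>

lemma LoopPlus_Int_LoopMinus_const:
  assumes birkhoff: "birkhoff_decomposition" and plus: "g \<in> LoopPlus" and minus: "g \<in> LoopMinus"
  obtains C where "C \<in> SU2" "\<And>t. t \<noteq> 0 \<Longrightarrow> g t = C"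
proof -
  have g: "g \<in> LoopSU2"
    using plus by (simp add: LoopPlus_def)
  obtain c where c: "expansion_minus g c"
    using minus by (auto simp: LoopMinus_def)
  define C where "C = c 0"
  have lim: "((\<lambda>s. g (inverse s)) \<longlongrightarrow> C) (at 0)"
    using c expansion_plus_tendsto unfolding C_def expansion_minus_iff_plus by blast
  have C: "C \<in> SU2"
  proof (rule Lim_in_closed_set[OF closed_SU2 _ _ lim])
    show "\<forall>\<^sub>F s in at 0. g (inverse s) \<in> SU2"
      using LoopSU2_SU2[OF g] by (auto simp: eventually_at_filter)
  qed simp
  \<comment> \<open>The limits along \<open>s\<close> and \<open>- s\<close> coincide, while the
    twisting condition turns one into the \<open>sigma3\<close>-conjugate of the other. Hence the
    constant loop \<open>C\<close> is twisted.\<close>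
  have twist: "sigma3 ** C ** sigma3 = C"
  proof (rule tendsto_unique)
    have "filterlim uminus (at 0) (at (0::real))"
      by (auto simp: filterlim_at eventually_at_filter intro!: tendsto_eq_intros)
    from filterlim_compose[OF lim this] show "((\<lambda>s. g (inverse (- s))) \<longlongrightarrow> C) (at 0)" .
    have "((\<lambda>s. sigma3 ** g (inverse s) ** sigma3) \<longlongrightarrow> sigma3 ** C ** sigma3) (at 0)"
      by (intro bounded_bilinear.tendsto[OF bounded_bilinear_matrix_mult2] tendsto_const lim)
    moreover have "\<forall>\<^sub>F s in at 0. sigma3 ** g (inverse s) ** sigma3 = g (inverse (- s))"
      using g by (auto simp: LoopSU2_def matrix_inv_sigma3 eventually_at_filter)
    ultimately show "((\<lambda>s. g (inverse (- s))) \<longlongrightarrow> sigma3 ** C ** sigma3) (at 0)"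
      by (rule Lim_transform_eventually)
  qed simp
  define k :: loop where "k = (\<lambda>t\<in>-{0}. C)"
  define e :: loop where "e = (\<lambda>t\<in>-{0}. mat 1)"
  have kL: "k \<in> LoopSU2" and kE: "k \<in> LoopPlus"
    using LoopSU2_const[OF C twist] expansion_loop_const[of C] by (auto simp: k_def LoopPlus_def)
  have "mat 1 \<in> SU2" "sigma3 ** mat 1 ** sigma3 = mat 1"
    by (simp_all add: SU2_def cadjoint_def matrix2_simps)
  then have e: "e \<in> LoopMinusStar"
    unfolding e_def LoopMinusStar_def
    using LoopSU2_const expansion_loop_const(2)[of "mat 1"] by fastforce
  have "expansion_minus k (\<lambda>n. if n = 0 then C else 0)"
    using expansion_loop_const unfolding k_def by blast
  \<comment> \<open>The leading coefficient of this product is \<open>c 0 ** adjugate2 C\<close>,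
    the identity; this is the normalization required by \<open>LoopMinusStar\<close>.\<close>
  note expansion_loop_mult(2)[OF c expansion_loop_inv(2)[OF this]]
  then have gk: "g \<cdot>\<^sub>l loop_inv k \<in> LoopMinusStar"
    using LoopSU2_mult[OF g LoopSU2_inv[OF kL]] adjugate2_right[OF SU2_det[OF C]]
    by (fastforce simp: LoopMinusStar_def C_def)
  have 1: "e \<cdot>\<^sub>l g = g \<cdot>\<^sub>l loop_inv k \<cdot>\<^sub>l k"
    by (auto simp: loop_mult_def e_def k_def loop_inv_def fun_eq_iff matrix_mul_assoc[symmetric]
        adjugate2_left[OF SU2_det[OF C]] restrict_def)
  have "inj_on (\<lambda>(a, b). a \<cdot>\<^sub>l b) (LoopMinusStar \<times> LoopPlus)"
    using birkhoff by (simp add: birkhoff_decomposition_def mult_diffeomorphism_def bij_betw_def)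
  from inj_onD[OF this, of "(e, g)" "(g \<cdot>\<^sub>l loop_inv k, k)"] have "g = k"
    using 1 e gk plus kE by simp
  then show thesis
    using that[OF C] by (simp add: k_def)
qed

subsection \<open>Smooth families of loops\<close>

lemma smooth_loops_on_cong:
  "(\<And>p. p \<in> D \<Longrightarrow> f p = g p) \<Longrightarrow> smooth_loops_on D f \<longleftrightarrow> smooth_loops_on D g"
  by (simp add: smooth_loops_on_def)

text \<open>Extensions multiply pointwise, and matrix multiplication is bilinear, so joint
  smoothness in the point and the parameter is kept.\<close>

lemma smooth_loops_on_mult:
  assumes "open D" "smooth_loops_on D f" "smooth_loops_on D g"
  shows "smooth_loops_on D (\<lambda>p. f p \<cdot>\<^sub>l g p)"
proof -
  obtain F G where
    F: "\<forall>p\<in>D. analytic_extension (f p) (F p)" "smooth_on (D \<times> -{0}) (\<lambda>(p, z). F p z)" and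
    G: "\<forall>p\<in>D. analytic_extension (g p) (G p)" "smooth_on (D \<times> -{0}) (\<lambda>(p, z). G p z)"
    using assms by (auto simp: smooth_loops_on_def)
  have "smooth_on (D \<times> -{0}) (\<lambda>(p, z). F p z ** G p z)"
    using F(2) G(2) assms(1) unfolding smooth_on_def split_def
    by (intro allI Ck_on_bilinear[OF _ bounded_bilinear_matrix_mult2]) (auto intro: open_Times)
  moreover have "\<forall>p\<in>D. analytic_extension (f p \<cdot>\<^sub>l g p) (\<lambda>z. F p z ** G p z)"
    using F G analytic_extension_mult by blast
  ultimately show ?thesis
    using assms LoopSU2_mult unfolding smooth_loops_on_def
    by (intro conjI exI[of _ "\<lambda>p z. F p z ** G p z"]) auto
qed

lemma smooth_loops_on_inv:
  assumes "open D" "smooth_loops_on D f"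
  shows "smooth_loops_on D (\<lambda>p. loop_inv (f p))"
proof -
  obtain F where
    F: "\<forall>p\<in>D. analytic_extension (f p) (F p)" "smooth_on (D \<times> -{0}) (\<lambda>(p, z). F p z)"
    using assms by (auto simp: smooth_loops_on_def)
  have "smooth_on (D \<times> -{0}) (\<lambda>(p, z). adjugate2 (F p z))"
    using F(2) assms(1) unfolding smooth_on_def split_def
    by (intro allI Ck_on_linear[OF _ bounded_linear_adjugate2]) (auto intro: open_Times)
  moreover have "\<forall>p\<in>D. analytic_extension (loop_inv (f p)) (\<lambda>z. adjugate2 (F p z))"
    using F analytic_extension_inv by blast
  ultimately show ?thesis
    using assms LoopSU2_inv unfolding smooth_loops_on_def
    by (intro conjI exI[of _ "\<lambda>p z. adjugate2 (F p z)"]) auto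
qed

text \<open>Freezing the complex parameter at a real value keeps smoothness in the point, and there
  the extension is the loop itself.\<close>

lemma smooth_loops_on_eval:
  assumes "open D" "smooth_loops_on D f" "t \<noteq> 0"
  shows "smooth_on D (\<lambda>p. f p t)"
proof -
  obtain F where
    F: "\<forall>p\<in>D. analytic_extension (f p) (F p)" "smooth_on (D \<times> -{0}) (\<lambda>(p, z). F p z)"
    using assms by (auto simp: smooth_loops_on_def)
  have "smooth_on D (\<lambda>p. F p (complex_of_real t))"
    by (rule smooth_on_section[OF assms(1) _ _ F(2)]) (simp_all add: assms(3) open_Compl)
  moreover have "F p (complex_of_real t) = f p t" if "p \<in> D" for p
    using F(1)[rule_format, OF that] assms(3) unfolding analytic_extension_def by blast
  ultimately show ?thesis
    unfolding smooth_on_def by (metis Ck_on_cong[OF assms(1), of "\<lambda>p. F p (complex_of_real t)" "\<lambda>p. f p t"])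
qed

section \<open>Construction of \<open>U\<close> from the Birkhoff factors, and its equivariance
  under \<open>\<gamma>\<close>\<close>

theorem proposition3p5:
  fixes D :: "(real \<times> real) set"
    and \<gamma> :: "real \<times> real \<Rightarrow> real \<times> real"
    and GX GY WX WY :: "real \<times> real \<Rightarrow> loop"
    and chi :: "real \<Rightarrow> complex^2^2"
  assumes birkhoff: "birkhoff_decomposition"
    and "open D"
    and "diffeomorphism_on D \<gamma>"
    and "preserves_coordinate_lines D \<gamma>"
    and "smooth_loops_on D GX" and "indep_y_on D GX"
    and "smooth_loops_on D GY" and "indep_x_on D GY"
    and "\<And>p. p \<in> D \<Longrightarrow> WY p \<in> LoopPlus" and "indep_x_on D WY"
    and "\<And>p. p \<in> D \<Longrightarrow> WX p \<in> LoopMinus" and "indep_y_on D WX"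
    and "\<And>t. t \<noteq> 0 \<Longrightarrow> chi t \<in> SU2"
    and "\<And>p t. p \<in> D \<Longrightarrow> t \<noteq> 0 \<Longrightarrow> GY (\<gamma> p) t = chi t ** GY p t ** WY p t"
    and "\<And>p t. p \<in> D \<Longrightarrow> t \<noteq> 0 \<Longrightarrow> GX (\<gamma> p) t = chi t ** GX p t ** WX p t"
  shows "\<exists>(U :: real \<times> real \<Rightarrow> loop) (Lplus :: real \<times> real \<Rightarrow> loop)
            (Lminus :: real \<times> real \<Rightarrow> loop) (K :: real \<times> real \<Rightarrow> complex^2^2).
      smooth_loops_on D U \<and>
      smooth_loops_on D Lplus \<and> (\<forall>p\<in>D. Lplus p \<in> LoopPlus) \<and>
      smooth_loops_on D Lminus \<and> (\<forall>p\<in>D. Lminus p \<in> LoopMinus) \<and>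
      smooth_on D K \<and> (\<forall>p\<in>D. K p \<in> SU2) \<and>
      (\<forall>p\<in>D. \<forall>t. t \<noteq> 0 \<longrightarrow> U p t = GY p t ** Lplus p t \<and> U p t = GX p t ** Lminus p t) \<and>
      (\<forall>p\<in>D. \<forall>t. t \<noteq> 0 \<longrightarrow> U (\<gamma> p) t = chi t ** U p t ** K p)"
proof -
  note WY = assms(9) and WX = assms(11) and chi = assms(13) and GY_\<gamma> = assms(14) and GX_\<gamma> = assms(15)
  have \<gamma>: "\<gamma> ` D \<subseteq> D" "\<And>p. p \<in> D \<Longrightarrow> \<gamma> p \<in> D" "smooth_on D \<gamma>"
    using \<open>diffeomorphism_on D \<gamma>\<close> by (auto simp: diffeomorphism_on_def bij_betw_def)
  have GX: "GX p \<in> LoopSU2" and GY: "GY p \<in> LoopSU2" if "p \<in> D" for p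
    using that \<open>smooth_loops_on D GX\<close> \<open>smooth_loops_on D GY\<close> by (auto simp: smooth_loops_on_def)
  have bij: "bij_betw (\<lambda>(a, b). a \<cdot>\<^sub>l b) (LoopMinusStar \<times> LoopPlus) LoopSU2"
    and diffeo: "\<And>a b. \<forall>p\<in>D. a p \<in> LoopMinusStar \<and> b p \<in> LoopPlus \<Longrightarrow>
      smooth_loops_on D (\<lambda>p. a p \<cdot>\<^sub>l b p) \<Longrightarrow> smooth_loops_on D a \<and> smooth_loops_on D b"
    using birkhoff \<open>open D\<close> by (simp_all add: birkhoff_decomposition_def mult_diffeomorphism_def)
  \<comment> \<open>Surjectivity of the multiplication map factors the loop at each point
    separately. Smoothness of the chosen factors in \<open>p\<close> comes later from
    \<open>diffeo\<close>.\<close>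
  have "\<exists>x\<in>LoopMinusStar \<times> LoopPlus. loop_inv (GX p) \<cdot>\<^sub>l GY p = fst x \<cdot>\<^sub>l snd x" if "p \<in> D" for p
  proof -
    have "loop_inv (GX p) \<cdot>\<^sub>l GY p \<in> (\<lambda>(a, b). a \<cdot>\<^sub>l b) ` (LoopMinusStar \<times> LoopPlus)"
      using bij_betw_imp_surj_on[OF bij] LoopSU2_mult[OF LoopSU2_inv[OF GX[OF that]] GY[OF that]] by simp
    then show ?thesis
      by (simp only: image_iff split_def)
  qed
  then obtain H where H': "\<And>p. p \<in> D \<Longrightarrow> H p \<in> LoopMinusStar \<times> LoopPlus"
    "\<And>p. p \<in> D \<Longrightarrow> loop_inv (GX p) \<cdot>\<^sub>l GY p = fst (H p) \<cdot>\<^sub>l snd (H p)"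
    by metis
  define Hm where "Hm = (\<lambda>p. fst (H p))"
  define Hp where "Hp = (\<lambda>p. snd (H p))"
  have H: "Hm p \<in> LoopMinusStar" "Hp p \<in> LoopPlus"
    and GXGY: "loop_inv (GX p) \<cdot>\<^sub>l GY p = Hm p \<cdot>\<^sub>l Hp p" if "p \<in> D" for p
    using H'[OF that] by (auto simp: Hm_def Hp_def mem_Times_iff)
  have "smooth_loops_on D (\<lambda>p. loop_inv (GX p) \<cdot>\<^sub>l GY p)"
    by (intro smooth_loops_on_mult smooth_loops_on_inv assms)
  then have "smooth_loops_on D (\<lambda>p. Hm p \<cdot>\<^sub>l Hp p)"
    by (rule smooth_loops_on_cong[THEN iffD1, rotated]) (rule GXGY)
  then have smooth: "smooth_loops_on D Hm" "smooth_loops_on D Hp"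
    using diffeo H by blast+
  define Lp where "Lp = (\<lambda>p. loop_inv (Hp p))"
  define U where "U = (\<lambda>p. GX p \<cdot>\<^sub>l Hm p)"
  \<comment> \<open>This solves the desired equation for \<open>K\<close> at the loop parameter 1.
    The explicit formula gives smoothness, with \<open>chi 1\<close> entering as a constant
    matrix.\<close>
  define K where "K = (\<lambda>p. adjugate2 (U p 1) ** adjugate2 (chi 1) ** U (\<gamma> p) 1)"
  have Hm: "Hm p \<in> LoopMinus" and Lp: "Lp p \<in> LoopPlus" if "p \<in> D" for p
    using H[OF that] by (simp_all add: LoopMinusStar_LoopMinus Lp_def LoopPlus_inv)
  have smoothU: "smooth_loops_on D U"
    unfolding U_def by (intro smooth_loops_on_mult smooth assms)
  have U: "U p t \<in> SU2" if "p \<in> D" "t \<noteq> 0" for p t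
    using that smoothU LoopSU2_SU2 by (auto simp: smooth_loops_on_def)
  have UX: "U p t = GX p t ** Hm p t" if "t \<noteq> 0" for p t
    using that by (simp add: U_def)
  have UY: "U p t = GY p t ** Lp p t" if "p \<in> D" "t \<noteq> 0" for p t
  proof -
    note [simp] = LoopSU2_det[OF GX[OF that(1)] that(2)]
      LoopSU2_det[OF LoopPlus_LoopSU2[OF H(2)[OF that(1)]] that(2)]
    have "U p t = GX p t ** (Hm p t ** Hp p t) ** adjugate2 (Hp p t)"
      using that(2) by (simp add: UX matrix_mul_assoc[symmetric] adjugate2_right)
    also have "Hm p t ** Hp p t = adjugate2 (GX p t) ** GY p t"
      using that fun_cong[OF GXGY, of p t] by simp
    finally show ?thesis
      using that(2) by (simp add: adjugate2_cancel Lp_def)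
  qed
  have K: "\<exists>C\<in>SU2. \<forall>t. t \<noteq> 0 \<longrightarrow> U (\<gamma> p) t = chi t ** U p t ** C" if p: "p \<in> D" for p
  proof -
    \<comment> \<open>\<open>chi\<close> is only a pointwise \<open>SU2\<close>-valued map, so
      \<open>k\<close> is built from the minus factors without \<open>chi\<close>; this makes it
      visibly a minus loop.\<close>
    define k where "k = loop_inv (Hm p) \<cdot>\<^sub>l WX p \<cdot>\<^sub>l Hm (\<gamma> p)"
    have X: "U (\<gamma> p) t = chi t ** U p t ** k t" if "t \<noteq> 0" for t
      using that p LoopSU2_det[OF LoopMinus_LoopSU2[OF Hm[OF p]] that]
      by (simp add: k_def UX GX_\<gamma> matrix_mul_assoc[symmetric] adjugate2_cancel)
    have Y: "U (\<gamma> p) t = chi t ** U p t ** (loop_inv (Lp p) \<cdot>\<^sub>l WY p \<cdot>\<^sub>l Lp (\<gamma> p)) t" if "t \<noteq> 0" for t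
      using that p \<gamma>(2) LoopSU2_det[OF LoopPlus_LoopSU2[OF Lp[OF p]] that]
      by (simp add: UY GY_\<gamma> matrix_mul_assoc[symmetric] adjugate2_cancel)
    have "k \<in> LoopMinus"
      unfolding k_def using p Hm WX \<gamma>(2) by (intro LoopMinus_mult LoopMinus_inv) auto
    moreover have kp: "loop_inv (Lp p) \<cdot>\<^sub>l WY p \<cdot>\<^sub>l Lp (\<gamma> p) \<in> LoopPlus"
      using p Lp WY \<gamma>(2) by (intro LoopPlus_mult LoopPlus_inv) auto
    moreover have "k = loop_inv (Lp p) \<cdot>\<^sub>l WY p \<cdot>\<^sub>l Lp (\<gamma> p)"
    \<comment> \<open>\<open>X\<close> and \<open>Y\<close> express the same matrix, and the common
      factor \<open>chi t ** U p t\<close> has determinant 1, so it cancels at every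
      parameter.\<close>
    proof (rule loop_eqI)
      fix t :: real
      assume t: "t \<noteq> 0"
      then have "det (chi t ** U p t) = 1"
        by (intro SU2_det SU2_mult chi U p)
      then show "k t = (loop_inv (Lp p) \<cdot>\<^sub>l WY p \<cdot>\<^sub>l Lp (\<gamma> p)) t"
        using X[OF t] Y[OF t] adjugate2_cancel(2) by metis
    qed (use \<open>k \<in> LoopMinus\<close> kp in \<open>simp_all add: LoopMinus_LoopSU2 LoopPlus_LoopSU2\<close>)
    ultimately obtain C where "C \<in> SU2" "\<And>t. t \<noteq> 0 \<Longrightarrow> k t = C"
      using LoopPlus_Int_LoopMinus_const[OF birkhoff] by metis
    then show ?thesis
      using X by metis
  qed
  have KC: "K p \<in> SU2 \<and> (\<forall>t. t \<noteq> 0 \<longrightarrow> U (\<gamma> p) t = chi t ** U p t ** K p)" if p: "p \<in> D" for p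
  proof -
    obtain C where C: "C \<in> SU2" "\<And>t. t \<noteq> 0 \<Longrightarrow> U (\<gamma> p) t = chi t ** U p t ** C"
      using K[OF p] by blast
    have "det (chi 1 ** U p 1) = 1"
      by (intro SU2_det SU2_mult chi U p) simp_all
    \<comment> \<open>The constant \<open>C\<close> satisfies the equation at every parameter; its
      instance at 1 identifies it with the explicit \<open>K p\<close>.\<close>
    then have "K p = C"
      using C(2)[of 1] by (simp add: K_def adjugate2_mult[symmetric] adjugate2_cancel)
    then show ?thesis using C by blast
  qed
  have smoothU1: "smooth_on D (\<lambda>p. U p 1)"
    by (rule smooth_loops_on_eval[OF \<open>open D\<close> smoothU]) simp
  have smoothU\<gamma>: "smooth_on D (\<lambda>p. U (\<gamma> p) 1)"
    using smoothU1 \<gamma>(3) unfolding smooth_on_def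
    by (intro allI Ck_on_compose[OF \<open>open D\<close> \<open>open D\<close> \<gamma>(1), of _ "\<lambda>p. U p 1"]) (rule spec, assumption)+
  have smoothK: "smooth_on D K"
    using smoothU1 smoothU\<gamma> unfolding K_def smooth_on_def
    by (intro allI Ck_on_bilinear[OF \<open>open D\<close> bounded_bilinear_matrix_mult2]
        Ck_on_linear[OF \<open>open D\<close> bounded_linear_adjugate2] Ck_on_const[OF \<open>open D\<close>]) auto
  have smoothLp: "smooth_loops_on D Lp"
    unfolding Lp_def by (rule smooth_loops_on_inv[OF \<open>open D\<close> smooth(2)])
  show ?thesis
    by (rule exI[of _ U], rule exI[of _ Lp], rule exI[of _ Hm], rule exI[of _ K])
      (intro conjI ballI allI impI; (rule smoothU smoothLp smooth smoothK Lp Hm UX UY KC[THEN conjunct1]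
        KC[THEN conjunct2, rule_format]; assumption))
qed

end
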